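(* For all $n\ge1$ and all $s$, $$\ddot H_n\Bigl(\frac{\cos x+\sin x}{(\cos x-\sin x)^{s}}\Bigr) =4^{\binom n2}\Bigl(\prod_{k=1}^{n-1}k!\Bigr) \prod_{j=0}^{n-2}\bigl[(s+2j)(s+2j+1)\bigr]^{\,n-1-j}.$$
   Context: For a formal power series $f(x)=\sum_{k\ge0}a_kx^k/k!$ in $x$, the dilated Hankel determinant is $\ddot H_n(f)=\det(a_{2i+j})_{0\le i,j\le n-1}$. Here $s$ is a parameter and $(\cos x-\sin x)^{-s}$ is expanded as the power series in $x$ with constant term $1$, its coefficients being polynomials in $s$. Empty products equal $1$. *)

theory Defs
  imports
    "HOL-Computational_Algebra.Formal_Power_Series"
    "Jordan_Normal_Form.Determinant"
begin

(* u^s for a power series u with constant term 1: the binomial series (1 + X)^s composed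
   with u - 1, so the constant term is again 1 and the coefficients are polynomials in s.
   The composition is meaningful only when u has constant term 1. *)
definition fps_pow :: "'a::field_char_0 fps \<Rightarrow> 'a \<Rightarrow> 'a fps" where
  "fps_pow u s = fps_compose (fps_binomial s) (u - 1)"

lemma fps_pow_of_nat:
  fixes u :: "'a::field_char_0 fps"
  assumes "fps_nth u 0 = 1"
  shows "fps_pow u (of_nat n) = u ^ n"
  using assms
  by (simp add: fps_pow_def fps_binomial_of_nat fps_compose_power [symmetric]
      fps_compose_add_distrib)

definition egf_coeff :: "'a::field_char_0 fps \<Rightarrow> nat \<Rightarrow> 'a" where
  "egf_coeff f k = fact k * fps_nth f k"

definition dilated_hankel :: "nat \<Rightarrow> 'a::field_char_0 fps \<Rightarrow> 'a" where
  "dilated_hankel n f = det (mat n n (\<lambda>(i, j). egf_coeff f (2 * i + j)))"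

end

theory Submission
  imports Defs
begin

text \<open>Write \<open>u = cos x - sin x\<close>, \<open>v = cos x + sin x\<close>, \<open>f\<^sub>t = v u\<^bsup>-t\<^esup>\<close>. Since \<open>u' = -v\<close>, \<open>v' = u\<close>
  and \<open>u\<^sup>2 + v\<^sup>2 = 2\<close>, one has \<open>f\<^sub>t'' = 2 t (t + 1) f\<^bsub>t+2\<^esub> - (t - 1)\<^sup>2 f\<^sub>t\<close>; hence the even
  derivatives of \<open>f\<^sub>s\<close> are obtained from \<open>f\<^sub>s, f\<^bsub>s+2\<^esub>, f\<^bsub>s+4\<^esub>, \<dots>\<close> by a lower triangular matrix.
  With \<open>u\<^bsup>-2\<^esup> = 1 + y\<close>, the binomial theorem expresses \<open>f\<^bsub>s+2m\<^esub> = f\<^sub>s (1 + y)\<^sup>m\<close> through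
  \<open>f\<^sub>s y\<^sup>k\<close> by a unitriangular matrix, and as \<open>y = 2 x + \<dots>\<close> the coefficients of the \<open>f\<^sub>s y\<^sup>k\<close>
  form an upper triangular matrix. The determinant is the product of the three diagonals.\<close>

text \<open>The matrix is a product, so its determinant splits. Used twice: with the coefficients of
  the even derivatives and with the binomial coefficients as \<open>a\<close>.\<close>

lemma det_lower_triangular_factor:
  fixes a b :: "nat \<Rightarrow> nat \<Rightarrow> 'a::comm_ring_1"
  assumes lower: "\<And>i k. i < k \<Longrightarrow> a i k = 0"
  shows "det (mat n n (\<lambda>(i, j). \<Sum>k<n. a i k * b k j)) =
    (\<Prod>i<n. a i i) * det (mat n n (\<lambda>(i, j). b i j))"
proof -
  have "mat n n (\<lambda>(i, j). \<Sum>k<n. a i k * b k j) =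
      mat n n (\<lambda>(i, j). a i j) * mat n n (\<lambda>(i, j). b i j)"
    by (rule eq_matI) (auto simp: scalar_prod_def lessThan_atLeast0)
  moreover have "det (mat n n (\<lambda>(i, j). a i j)) = (\<Prod>i<n. a i i)"
    by (subst det_lower_triangular[of n])
      (auto simp: lower diag_mat_def prod.list_conv_set_nth lessThan_atLeast0)
  ultimately show ?thesis
    by (simp add: det_mult[of _ n])
qed

section \<open>Exponential coefficients\<close>

lemma egf_coeff_const_mult: "egf_coeff (fps_const c * f) k = c * egf_coeff f k"
  by (simp add: egf_coeff_def algebra_simps)

lemma egf_coeff_sum: "egf_coeff (\<Sum>i\<in>A. f i) k = (\<Sum>i\<in>A. egf_coeff (f i) k)"
  by (simp add: egf_coeff_def fps_sum_nth sum_distrib_left)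

lemma egf_coeff_deriv: "egf_coeff (fps_deriv f) k = egf_coeff f (Suc k)"
  by (simp add: egf_coeff_def algebra_simps)

text \<open>This makes row \<open>i\<close> of the dilated Hankel matrix the coefficient sequence of
  the derivative of order \<open>2 * i\<close>.\<close>

lemma egf_coeff_deriv2_power:
  "egf_coeff (((\<lambda>h. fps_deriv (fps_deriv h)) ^^ i) f) j = egf_coeff f (2 * i + j)"
  by (induction i arbitrary: j) (simp_all add: egf_coeff_deriv)

lemma egf_coeff_mult_power_eq_0:
  assumes "fps_nth y 0 = 0" "j < k"
  shows "egf_coeff (g * y ^ k) j = 0"
proof -
  have "fps_nth (y ^ k) (j - i) = 0" for i
    using assms startsby_zero_power_prefix[of y k] by auto
  then show ?thesis
    by (simp add: egf_coeff_def fps_mult_nth)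
qed

lemma egf_coeff_mult_power_same:
  assumes "fps_nth y 0 = 0"
  shows "egf_coeff (g * y ^ k) k = fact k * fps_nth g 0 * fps_nth y 1 ^ k"
proof -
  \<comment> \<open>\<open>y ^ k\<close> has order at least \<open>k\<close>, so in the Cauchy
    product only the constant term of \<open>g\<close> survives.\<close>
  have "fps_nth (y ^ k) (k - i) = 0" if "0 < i" "i \<le> k" for i
    using assms that startsby_zero_power_prefix[of y k] by auto
  then have "fps_nth (g * y ^ k) k = (\<Sum>i=0..k. if i = 0 then fps_nth g 0 * fps_nth (y ^ k) k else 0)"
    unfolding fps_mult_nth by (intro sum.cong) auto
  also have "\<dots> = fps_nth g 0 * fps_nth y 1 ^ k"
    using assms by (simp add: startsby_zero_power_nth_same)
  finally show ?thesis
    by (simp add: egf_coeff_def)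
qed

section \<open>Powers with arbitrary exponent\<close>

lemma fps_pow_0 [simp]: "fps_pow u 0 = 1"
  by (simp add: fps_pow_def)

lemma fps_pow_1:
  assumes "fps_nth u 0 = 1"
  shows "fps_pow u 1 = u"
  using fps_pow_of_nat[OF assms, of 1] by simp

lemma fps_pow_add:
  assumes "fps_nth u 0 = 1"
  shows "fps_pow u (a + b) = fps_pow u a * fps_pow u b"
  using assms by (simp add: fps_pow_def fps_binomial_add_mult fps_compose_mult_distrib)

lemma fps_pow_nth_0 [simp]: "fps_nth (fps_pow u a) 0 = 1"
  by (simp add: fps_pow_def)

lemma fps_pow_mult_nat:
  assumes "fps_nth u 0 = 1"
  shows "fps_pow u (of_nat m * a) = fps_pow u a ^ m"
  by (induction m) (simp_all add: fps_pow_add[OF assms] algebra_simps)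

lemma fps_deriv_fps_pow:
  assumes "fps_nth u 0 = 1"
  shows "fps_deriv (fps_pow u a) = fps_const a * fps_pow u (a - 1) * fps_deriv u"
proof -
  \<comment> \<open>\<open>fps_binomial_deriv\<close> has the quotient by \<open>1 + fps_X\<close>;
    cancelling it lowers the exponent by one.\<close>
  have "fps_deriv (fps_binomial a) = fps_const a * fps_binomial (a - 1)"
  proof -
    have "fps_binomial a = fps_binomial (a - 1) * (1 + fps_X)"
      using fps_binomial_add_mult[of "a - 1" 1] by (simp add: fps_binomial_1)
    moreover have "1 + fps_X \<noteq> (0 :: 'a fps)"
      by (metis fps_binomial_1 fps_binomial_nth gbinomial_0(1) fps_zero_nth zero_neq_one)
    ultimately show ?thesis
      unfolding fps_binomial_deriv by (metis mult.assoc nonzero_mult_div_cancel_right)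
  qed
  then show ?thesis
    using assms by (simp add: fps_pow_def fps_compose_deriv fps_compose_mult_distrib)
qed

section \<open>The trigonometric series and its differential equation\<close>

definition trig_u :: "'a::field_char_0 fps" where
  "trig_u = fps_cos 1 - fps_sin 1"

definition trig_fun :: "'a::field_char_0 \<Rightarrow> 'a fps" where
  "trig_fun t = (fps_cos 1 + fps_sin 1) * fps_pow trig_u (- t)"

lemma trig_u_nth_0 [simp]: "fps_nth trig_u 0 = 1"
  by (simp add: trig_u_def)

lemma trig_fun_deriv2:
  fixes t :: "'a::field_char_0"
  shows "fps_deriv (fps_deriv (trig_fun t)) =
    fps_const (2 * t * (t + 1)) * trig_fun (t + 2) - fps_const ((t - 1)\<^sup>2) * trig_fun t"
proof -
  define v :: "'a fps" where "v = fps_cos 1 + fps_sin 1"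
  let ?u = "trig_u :: 'a fps" and ?p = "fps_pow (trig_u :: 'a fps)"
  have du: "fps_deriv ?u = - v" and dv: "fps_deriv v = ?u"
    by (simp_all add: trig_u_def v_def fps_sin_deriv fps_cos_deriv flip: fps_const_neg)
  have sq: "v * v = fps_const 2 - ?u * ?u"
    using fps_sin_cos_sum_of_squares[of "1::'a"]
    by (simp add: v_def trig_u_def algebra_simps power2_eq_square numeral_fps_const[symmetric])
  have shift: "?p (1 + a) = ?u * ?p a" for a
    by (simp add: fps_pow_add fps_pow_1)
  have dp: "fps_deriv (?p a) = - (fps_const a * ?p (a - 1) * v)" for a
    by (simp add: fps_deriv_fps_pow du)
  have "fps_deriv (trig_fun t) = ?u * ?p (- t) + fps_const t * (v * v) * ?p (- t - 1)"
    by (simp add: trig_fun_def v_def[symmetric] dp dv algebra_simps flip: fps_const_neg)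
  \<comment> \<open>Eliminating \<open>v * v\<close> leaves pure powers of \<open>trig_u\<close>;
    differentiating each once more yields exactly one factor \<open>v\<close>, hence again a
    \<open>trig_fun\<close>.\<close>
  also have "\<dots> = fps_const (1 - t) * ?p (1 - t) + fps_const (2 * t) * ?p (- t - 1)"
    using shift[of "- t"] shift[of "- t - 1"] unfolding sq
    by (simp add: algebra_simps flip: fps_const_mult fps_const_sub)
  finally have d1: "fps_deriv (trig_fun t) = \<dots>" .
  show ?thesis
    unfolding d1
    by (simp add: dp trig_fun_def v_def[symmetric] algebra_simps power2_eq_square
        flip: fps_const_mult fps_const_sub fps_const_add fps_const_neg numeral_fps_const)
qed

section \<open>Triangular factorization of the Hankel matrix\<close>

context
  fixes s :: "'a::field_char_0"
begin

text \<open>The recurrence is \<open>trig_fun_deriv2\<close> at \<open>t = s + 2 * of_nat m\<close>: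
  each term feeds index \<open>m + 1\<close> and returns to index \<open>m\<close>.\<close>

fun deriv_coeff :: "nat \<Rightarrow> nat \<Rightarrow> 'a" where
  "deriv_coeff 0 m = (if m = 0 then 1 else 0)"
| "deriv_coeff (Suc i) m =
    (if m = 0 then 0
     else 2 * (s + 2 * of_nat (m - 1)) * (s + 2 * of_nat (m - 1) + 1) * deriv_coeff i (m - 1))
    - (s + 2 * of_nat m - 1)\<^sup>2 * deriv_coeff i m"

lemma deriv_coeff_eq_0: "i < m \<Longrightarrow> deriv_coeff i m = 0"
  by (induction i arbitrary: m) auto

lemma deriv_coeff_diag:
  "deriv_coeff i i = 2 ^ i * (\<Prod>j<i. (s + 2 * of_nat j) * (s + 2 * of_nat j + 1))"
  by (induction i) (simp_all add: deriv_coeff_eq_0 algebra_simps)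

lemma trig_fun_deriv2_power:
  "((\<lambda>h. fps_deriv (fps_deriv h)) ^^ i) (trig_fun s) =
    (\<Sum>m\<le>i. fps_const (deriv_coeff i m) * trig_fun (s + 2 * of_nat m))"
proof (induction i)
  case (Suc i)
  let ?F = "\<lambda>m. trig_fun (s + 2 * of_nat m)"
  let ?a = "\<lambda>m. 2 * (s + 2 * of_nat m) * (s + 2 * of_nat m + 1) * deriv_coeff i m"
  let ?b = "\<lambda>m. (s + 2 * of_nat m - 1)\<^sup>2 * deriv_coeff i m"
  have step: "fps_const (deriv_coeff i m) * fps_deriv (fps_deriv (?F m)) =
      fps_const (?a m) * ?F (Suc m) - fps_const (?b m) * ?F m" for m
  proof -
    have "s + 2 * of_nat m + 2 = s + 2 * of_nat (Suc m)"
      by simp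
    then show ?thesis
      unfolding trig_fun_deriv2 right_diff_distrib
      by (simp only: mult.assoc[symmetric] fps_const_mult)
        (simp only: mult.assoc mult.left_commute mult.commute)
  qed
  have "((\<lambda>h. fps_deriv (fps_deriv h)) ^^ Suc i) (trig_fun s) =
      (\<Sum>m\<le>i. fps_const (?a m) * ?F (Suc m)) - (\<Sum>m\<le>i. fps_const (?b m) * ?F m)"
    by (simp add: Suc.IH fps_deriv_sum step sum_subtractf del: of_nat_Suc)
  also have "(\<Sum>m\<le>i. fps_const (?a m) * ?F (Suc m)) =
      (\<Sum>m\<le>Suc i. fps_const (if m = 0 then 0 else ?a (m - 1)) * ?F m)"
    unfolding sum.atMost_Suc_shift by simp
  \<comment> \<open>The added term vanishes because
    \<open>deriv_coeff i (Suc i) = 0\<close>.\<close>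
  also have "(\<Sum>m\<le>i. fps_const (?b m) * ?F m) = (\<Sum>m\<le>Suc i. fps_const (?b m) * ?F m)"
    by (simp add: deriv_coeff_eq_0)
  finally show ?case
    by (simp only: deriv_coeff.simps sum_subtractf[symmetric] left_diff_distrib[symmetric]
        fps_const_sub)
qed simp

lemma egf_coeff_trig_fun_even_deriv:
  assumes "i < n"
  shows "egf_coeff (trig_fun s) (2 * i + j) =
    (\<Sum>m<n. deriv_coeff i m * egf_coeff (trig_fun (s + 2 * of_nat m)) j)"
proof -
  have "egf_coeff (trig_fun s) (2 * i + j) =
      (\<Sum>m\<le>i. deriv_coeff i m * egf_coeff (trig_fun (s + 2 * of_nat m)) j)"
    by (simp add: trig_fun_deriv2_power egf_coeff_sum egf_coeff_const_mult
        flip: egf_coeff_deriv2_power)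
  also have "\<dots> = (\<Sum>m<n. deriv_coeff i m * egf_coeff (trig_fun (s + 2 * of_nat m)) j)"
    by (rule sum.mono_neutral_left) (use assms in \<open>auto simp: not_le deriv_coeff_eq_0\<close>)
  finally show ?thesis .
qed

lemma egf_coeff_trig_fun_binomial:
  assumes "m < n"
  shows "egf_coeff (trig_fun (s + 2 * of_nat m)) j =
    (\<Sum>k<n. of_nat (m choose k) * egf_coeff (trig_fun s * (fps_pow trig_u (- 2) - 1) ^ k) j)"
proof -
  let ?y = "fps_pow trig_u (- 2) - 1 :: 'a fps"
  \<comment> \<open>The exponent \<open>- (s + 2 * of_nat m)\<close> splits as \<open>- s\<close>
    plus \<open>m\<close> times \<open>- 2\<close>.\<close>
  have "trig_fun (s + 2 * of_nat m) = trig_fun s * (?y + 1) ^ m"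
    using fps_pow_add[of trig_u "- s" "of_nat m * - 2"] fps_pow_mult_nat[of trig_u m "- 2 :: 'a"]
    by (simp add: trig_fun_def algebra_simps)
  also have "\<dots> = (\<Sum>k\<le>m. fps_const (of_nat (m choose k)) * (trig_fun s * ?y ^ k))"
    unfolding binomial_ring
    by (simp add: sum_distrib_left fps_of_nat algebra_simps)
  also have "\<dots> = (\<Sum>k<n. fps_const (of_nat (m choose k)) * (trig_fun s * ?y ^ k))"
    by (rule sum.mono_neutral_left) (use assms in \<open>auto simp: not_le binomial_eq_0\<close>)
  finally show ?thesis
    by (simp add: egf_coeff_sum egf_coeff_const_mult)
qed

lemma det_trig_fun_mult_powers:
  "det (mat n n (\<lambda>(k, j). egf_coeff (trig_fun s * (fps_pow trig_u (- 2) - 1) ^ k) j)) =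
    (\<Prod>k<n. fact k * 2 ^ k)"
proof -
  let ?y = "fps_pow trig_u (- 2) - 1 :: 'a fps"
  let ?A = "mat n n (\<lambda>(k, j). egf_coeff (trig_fun s * ?y ^ k) j)"
  have y0: "fps_nth ?y 0 = 0"
    by simp
  have "fps_nth ?y 1 = fps_nth (fps_deriv ?y) 0"
    by simp
  \<comment> \<open>The chain rule gives \<open>- 2\<close> times the constant term
    \<open>- 1\<close> of the derivative of \<open>trig_u\<close>.\<close>
  also have "\<dots> = 2"
    by (simp only: fps_deriv_sub fps_deriv_fps_pow trig_u_nth_0)
      (simp add: trig_u_def fps_sin_deriv fps_cos_deriv)
  finally have y1: "fps_nth ?y 1 = 2" .
  have g0: "fps_nth (trig_fun s) 0 = 1"
    by (simp add: trig_fun_def)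
  have "det ?A = prod_list (diag_mat ?A)"
    by (rule det_upper_triangular[of _ n]) (auto simp: egf_coeff_mult_power_eq_0[OF y0])
  also have "\<dots> = (\<Prod>k<n. fact k * 2 ^ k)"
    unfolding diag_mat_def prod.list_conv_set_nth
    by (rule prod.cong) (simp_all only: length_map length_upt nth_map nth_upt dim_row_mat index_mat
        egf_coeff_mult_power_same[OF y0] g0 y1 lessThan_atLeast0 atLeastLessThan_iff
        minus_nat.diff_0 add_0 prod.case mult_1_right)
  finally show ?thesis .
qed

lemma dilated_hankel_trig_fun:
  "dilated_hankel n (trig_fun s) = (\<Prod>i<n. deriv_coeff i i) * (\<Prod>k<n. fact k * 2 ^ k)"
proof -
  let ?M = "\<lambda>m j. egf_coeff (trig_fun (s + 2 * of_nat m)) j"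
  let ?Y = "\<lambda>k j. egf_coeff (trig_fun s * (fps_pow trig_u (- 2) - 1) ^ k) j"
  have "dilated_hankel n (trig_fun s) =
      det (mat n n (\<lambda>(i, j). \<Sum>m<n. deriv_coeff i m * ?M m j))"
    unfolding dilated_hankel_def
    by (intro arg_cong[of _ _ det] cong_mat) (auto simp: egf_coeff_trig_fun_even_deriv)
  also have "\<dots> = (\<Prod>i<n. deriv_coeff i i) * det (mat n n (\<lambda>(i, j). ?M i j))"
    by (rule det_lower_triangular_factor) (rule deriv_coeff_eq_0)
  also have "det (mat n n (\<lambda>(i, j). ?M i j)) =
      det (mat n n (\<lambda>(i, j). \<Sum>k<n. of_nat (i choose k) * ?Y k j))"
    by (intro arg_cong[of _ _ det] cong_mat) (auto simp: egf_coeff_trig_fun_binomial)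
  also have "\<dots> = (\<Prod>i<n. of_nat (i choose i)) * det (mat n n (\<lambda>(i, j). ?Y i j))"
    by (rule det_lower_triangular_factor) simp
  finally show ?thesis
    by (simp add: det_trig_fun_mult_powers)
qed

end

section \<open>Collecting the diagonal products\<close>

lemma prod_prod_lessThan_eq_prod_power:
  fixes c :: "nat \<Rightarrow> 'a::comm_monoid_mult"
  shows "(\<Prod>i<n. \<Prod>j<i. c j) = (\<Prod>j<n - 1. c j ^ (n - 1 - j))"
proof (induction n)
  case (Suc n)
  \<comment> \<open>The new row \<open>i = n\<close> contributes one more \<open>c j\<close> for
    every \<open>j < n\<close>.\<close>
  have "(\<Prod>j<n. c j ^ (n - j)) = (\<Prod>j<n. c j ^ (n - 1 - j) * c j)"
    by (rule prod.cong) (auto simp flip: power_Suc2 simp: Suc_diff_Suc)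
  also have "\<dots> = (\<Prod>j<n - 1. c j ^ (n - 1 - j)) * (\<Prod>j<n. c j)"
    \<comment> \<open>The index \<open>j = n - 1\<close> has exponent 0 and drops out.\<close>
    by (cases n) (simp_all add: prod.distrib)
  finally show ?case
    using Suc.IH by simp
qed simp

lemma prod_power_lessThan:
  fixes c :: "'a::comm_monoid_mult"
  shows "(\<Prod>i<n. c ^ i) = c ^ (n choose 2)"
  by (simp add: power_sum choose_two gauss_sum_nat Sum_Ico_nat lessThan_atLeast0 flip: power_sum)

theorem theorem17p1:
  fixes s :: "'a::field_char_0" and n :: nat
  assumes "n \<ge> 1"
  shows "dilated_hankel n ((fps_cos 1 + fps_sin 1) * fps_pow (fps_cos 1 - fps_sin 1) (- s)) =
    4 ^ (n choose 2) * (\<Prod>k = 1..n - 1. fact k) *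
      (\<Prod>j<n - 1. ((s + 2 * of_nat j) * (s + 2 * of_nat j + 1)) ^ (n - 1 - j))"
proof -
  have facts: "(\<Prod>k<n. fact k) = (\<Prod>k = 1..n - 1. fact k :: 'a)"
    by (rule prod.mono_neutral_right) (use assms in \<open>auto simp: not_le less_Suc_eq_0_disj\<close>)
  \<comment> \<open>One power of 2 comes from the diagonal of \<open>deriv_coeff\<close>, the other
    from the linear coefficient 2 of \<open>y\<close>.\<close>
  have "(4::'a) ^ (n choose 2) = 2 ^ (n choose 2) * 2 ^ (n choose 2)"
    by (simp flip: power_mult_distrib)
  then show ?thesis
    unfolding trig_u_def[symmetric] trig_fun_def[symmetric] dilated_hankel_trig_fun
      deriv_coeff_diag prod.distrib[of "\<lambda>k. 2 ^ k"] prod.distrib[of fact]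
      prod_power_lessThan facts prod_prod_lessThan_eq_prod_power
    by (simp only: mult_ac)
qed

end
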